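(* Let $\mathcal{C}$ be a category that admits all colimits (respectively limits). Then $\mathrm{C}_\infty(\mathcal{C})$ admits all colimits (respectively limits). If moreover $\mathcal{C}$ is pointed and $N\in\mathbb{N}$, then $\mathrm{C}_N(\mathcal{C})$ admits colimits and limits if $\mathcal{C}$ does.
   Context: An $\infty$-complex in $\mathcal{C}$ is a $\mathbb{Z}$-indexed diagram $\cdots\to X^{n-1}\xrightarrow{d_X}X^n\xrightarrow{d_X}X^{n+1}\to\cdots$ in $\mathcal{C}$ with no condition on $d_X$; a morphism is a family $g^i:X^i\to Y^i$ ($i\in\mathbb{Z}$) commuting with the differentials. These form $\mathrm{C}_\infty(\mathcal{C})$. A pointed category is a category with a zero object. For $\mathcal{C}$ pointed, $\mathrm{C}_N(\mathcal{C})$ is the full subcategory of $\mathrm{C}_\infty(\mathcal{C})$ of those $X$ with $d_X^N=0$. (Co)limits are indexed by small categories. *)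

theory Defs
  imports Main
begin

section \<open>Categories\<close>

record ('o, 'm) cat =
  Obj :: "'o set"
  Arr :: "'m set"
  Dom :: "'m \<Rightarrow> 'o"
  Cod :: "'m \<Rightarrow> 'o"
  Ident :: "'o \<Rightarrow> 'm"
  Comp :: "'m \<Rightarrow> 'm \<Rightarrow> 'm"

text \<open>\<open>Comp C g f\<close> is \<open>g\<close> after \<open>f\<close>; its value is irrelevant for non-composable arguments.\<close>

definition in_hom :: "('o, 'm) cat \<Rightarrow> 'm \<Rightarrow> 'o \<Rightarrow> 'o \<Rightarrow> bool" where
  "in_hom C f X Y \<longleftrightarrow>
     X \<in> Obj C \<and> Y \<in> Obj C \<and> f \<in> Arr C \<and> Dom C f = X \<and> Cod C f = Y"

locale category =
  fixes C :: "('o, 'm) cat"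
  assumes dom_cod: "f \<in> Arr C \<Longrightarrow> Dom C f \<in> Obj C \<and> Cod C f \<in> Obj C"
    and id_in_hom: "X \<in> Obj C \<Longrightarrow> in_hom C (Ident C X) X X"
    and comp_in_hom: "\<lbrakk>in_hom C f X Y; in_hom C g Y Z\<rbrakk> \<Longrightarrow> in_hom C (Comp C g f) X Z"
    and comp_id_right: "in_hom C f X Y \<Longrightarrow> Comp C f (Ident C X) = f"
    and comp_id_left: "in_hom C f X Y \<Longrightarrow> Comp C (Ident C Y) f = f"
    and comp_assoc: "\<lbrakk>in_hom C f W X; in_hom C g X Y; in_hom C h Y Z\<rbrakk>
      \<Longrightarrow> Comp C h (Comp C g f) = Comp C (Comp C h g) f"

definition full_subcat :: "('o, 'm) cat \<Rightarrow> 'o set \<Rightarrow> ('o, 'm) cat" where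
  "full_subcat C S =
     C\<lparr>Obj := Obj C \<inter> S, Arr := {f \<in> Arr C. Dom C f \<in> S \<and> Cod C f \<in> S}\<rparr>"

definition zero_object :: "('o, 'm) cat \<Rightarrow> 'o \<Rightarrow> bool" where
  "zero_object C Z \<longleftrightarrow> Z \<in> Obj C \<and>
     (\<forall>X\<in>Obj C. (\<exists>!f. in_hom C f X Z) \<and> (\<exists>!f. in_hom C f Z X))"

definition pointed :: "('o, 'm) cat \<Rightarrow> bool" where
  "pointed C \<longleftrightarrow> (\<exists>Z. zero_object C Z)"

definition zero_arrow :: "('o, 'm) cat \<Rightarrow> 'm \<Rightarrow> bool" where
  "zero_arrow C f \<longleftrightarrow> f \<in> Arr C \<and>
     (\<exists>Z a b. zero_object C Z \<and> in_hom C a (Dom C f) Z \<and> in_hom C b Z (Cod C f) \<and>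
              f = Comp C b a)"


section \<open>Limits and colimits\<close>

definition is_functor ::
    "('j, 'k) cat \<Rightarrow> ('o, 'm) cat \<Rightarrow> ('j \<Rightarrow> 'o) \<Rightarrow> ('k \<Rightarrow> 'm) \<Rightarrow> bool" where
  "is_functor J C Fo Fa \<longleftrightarrow>
     (\<forall>j\<in>Obj J. Fo j \<in> Obj C) \<and>
     (\<forall>u i j. in_hom J u i j \<longrightarrow> in_hom C (Fa u) (Fo i) (Fo j)) \<and>
     (\<forall>j\<in>Obj J. Fa (Ident J j) = Ident C (Fo j)) \<and>
     (\<forall>u v i j k. in_hom J u i j \<and> in_hom J v j k \<longrightarrow>
        Fa (Comp J v u) = Comp C (Fa v) (Fa u))"

definition is_cone ::
    "('j, 'k) cat \<Rightarrow> ('o, 'm) cat \<Rightarrow> ('j \<Rightarrow> 'o) \<Rightarrow> ('k \<Rightarrow> 'm) \<Rightarrow> 'o \<Rightarrow> ('j \<Rightarrow> 'm) \<Rightarrow> bool" where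
  "is_cone J C Fo Fa L p \<longleftrightarrow> L \<in> Obj C \<and>
     (\<forall>j\<in>Obj J. in_hom C (p j) L (Fo j)) \<and>
     (\<forall>u i j. in_hom J u i j \<longrightarrow> Comp C (Fa u) (p i) = p j)"

definition is_limit ::
    "('j, 'k) cat \<Rightarrow> ('o, 'm) cat \<Rightarrow> ('j \<Rightarrow> 'o) \<Rightarrow> ('k \<Rightarrow> 'm) \<Rightarrow> 'o \<Rightarrow> ('j \<Rightarrow> 'm) \<Rightarrow> bool" where
  "is_limit J C Fo Fa L p \<longleftrightarrow> is_cone J C Fo Fa L p \<and>
     (\<forall>M q. is_cone J C Fo Fa M q \<longrightarrow>
        (\<exists>!h. in_hom C h M L \<and> (\<forall>j\<in>Obj J. Comp C (p j) h = q j)))"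

definition is_cocone ::
    "('j, 'k) cat \<Rightarrow> ('o, 'm) cat \<Rightarrow> ('j \<Rightarrow> 'o) \<Rightarrow> ('k \<Rightarrow> 'm) \<Rightarrow> 'o \<Rightarrow> ('j \<Rightarrow> 'm) \<Rightarrow> bool" where
  "is_cocone J C Fo Fa L p \<longleftrightarrow> L \<in> Obj C \<and>
     (\<forall>j\<in>Obj J. in_hom C (p j) (Fo j) L) \<and>
     (\<forall>u i j. in_hom J u i j \<longrightarrow> Comp C (p j) (Fa u) = p i)"

definition is_colimit ::
    "('j, 'k) cat \<Rightarrow> ('o, 'm) cat \<Rightarrow> ('j \<Rightarrow> 'o) \<Rightarrow> ('k \<Rightarrow> 'm) \<Rightarrow> 'o \<Rightarrow> ('j \<Rightarrow> 'm) \<Rightarrow> bool" where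
  "is_colimit J C Fo Fa L p \<longleftrightarrow> is_cocone J C Fo Fa L p \<and>
     (\<forall>M q. is_cocone J C Fo Fa M q \<longrightarrow>
        (\<exists>!h. in_hom C h L M \<and> (\<forall>j\<in>Obj J. Comp C h (p j) = q j)))"

text \<open>
  Smallness is relative to a universe: \<open>U\<close> is the collection of those subsets of the type
  \<open>'u\<close> that count as small sets, and an index category is small if its objects and its arrows
  form members of \<open>U\<close>. No closure properties of \<open>U\<close> are built in, so statements
  quantified over \<open>U\<close> and \<open>'u\<close> cover every Grothendieck universe as well as, with
  \<open>U = UNIV\<close>, all index categories carried by a given type.
\<close>

definition small_category :: "'u set set \<Rightarrow> ('u, 'u) cat \<Rightarrow> bool" where
  "small_category U J \<longleftrightarrow> category J \<and> Obj J \<in> U \<and> Arr J \<in> U"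

definition has_limits :: "'u set set \<Rightarrow> ('o, 'm) cat \<Rightarrow> bool" where
  "has_limits U C \<longleftrightarrow>
     (\<forall>J Fo Fa. small_category U J \<and> is_functor J C Fo Fa \<longrightarrow>
        (\<exists>L p. is_limit J C Fo Fa L p))"

definition has_colimits :: "'u set set \<Rightarrow> ('o, 'm) cat \<Rightarrow> bool" where
  "has_colimits U C \<longleftrightarrow>
     (\<forall>J Fo Fa. small_category U J \<and> is_functor J C Fo Fa \<longrightarrow>
        (\<exists>L p. is_colimit J C Fo Fa L p))"


section \<open>Complexes\<close>

record ('o, 'm) cpx =
  ob :: "int \<Rightarrow> 'o"
  diff :: "int \<Rightarrow> 'm"

text \<open>A morphism carries its source and target, since the components do not determine the
  differentials.\<close>

record ('o, 'm) cpx_map =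
  src :: "('o, 'm) cpx"
  trg :: "('o, 'm) cpx"
  part :: "int \<Rightarrow> 'm"

definition is_complex :: "('o, 'm) cat \<Rightarrow> ('o, 'm) cpx \<Rightarrow> bool" where
  "is_complex C X \<longleftrightarrow> (\<forall>n. in_hom C (diff X n) (ob X n) (ob X (n + 1)))"

definition is_complex_map :: "('o, 'm) cat \<Rightarrow> ('o, 'm) cpx_map \<Rightarrow> bool" where
  "is_complex_map C f \<longleftrightarrow> is_complex C (src f) \<and> is_complex C (trg f) \<and>
     (\<forall>i. in_hom C (part f i) (ob (src f) i) (ob (trg f) i)) \<and>
     (\<forall>i. Comp C (diff (trg f) i) (part f i) = Comp C (part f (i + 1)) (diff (src f) i))"

definition C_inf :: "('o, 'm) cat \<Rightarrow> (('o, 'm) cpx, ('o, 'm) cpx_map) cat" where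
  "C_inf C = \<lparr>
     Obj = {X. is_complex C X},
     Arr = {f. is_complex_map C f},
     Dom = src,
     Cod = trg,
     Ident = (\<lambda>X. \<lparr>src = X, trg = X, part = (\<lambda>i. Ident C (ob X i))\<rparr>),
     Comp = (\<lambda>g f. \<lparr>src = src f, trg = trg g, part = (\<lambda>i. Comp C (part g i) (part f i))\<rparr>)\<rparr>"

text \<open>\<open>diff_pow C X N n\<close> is the \<open>N\<close>-fold composite of differentials from
  \<open>ob X n\<close> to \<open>ob X (n + N)\<close>.\<close>

primrec diff_pow :: "('o, 'm) cat \<Rightarrow> ('o, 'm) cpx \<Rightarrow> nat \<Rightarrow> int \<Rightarrow> 'm" where
  "diff_pow C X 0 n = Ident C (ob X n)"
| "diff_pow C X (Suc N) n = Comp C (diff X (n + int N)) (diff_pow C X N n)"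

definition C_N :: "nat \<Rightarrow> ('o, 'm) cat \<Rightarrow> (('o, 'm) cpx, ('o, 'm) cpx_map) cat" where
  "C_N N C = full_subcat (C_inf C) {X. \<forall>n. zero_arrow C (diff_pow C X N n)}"


section \<open>Well-definedness\<close>

lemma category_full_subcat:
  assumes "category C"
  shows "category (full_subcat C S)"
proof -
  interpret category C by fact
  have hom: "in_hom (full_subcat C S) f X Y \<longleftrightarrow> in_hom C f X Y \<and> X \<in> S \<and> Y \<in> S" for f X Y
    by (auto simp: in_hom_def full_subcat_def)
  have sel: "Comp (full_subcat C S) = Comp C" "Ident (full_subcat C S) = Ident C"
    by (simp_all add: full_subcat_def)
  show ?thesis
  proof (unfold_locales, unfold hom sel)
    fix f assume "f \<in> Arr (full_subcat C S)"
    then show "Dom (full_subcat C S) f \<in> Obj (full_subcat C S) \<and>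
               Cod (full_subcat C S) f \<in> Obj (full_subcat C S)"
      using dom_cod by (auto simp: full_subcat_def)
  next
    fix X assume "X \<in> Obj (full_subcat C S)"
    then show "in_hom C (Ident C X) X X \<and> X \<in> S \<and> X \<in> S"
      using id_in_hom by (auto simp: full_subcat_def)
  qed (blast intro: comp_in_hom comp_id_left comp_id_right comp_assoc)+
qed

lemma in_hom_C_inf:
  "in_hom (C_inf C) f X Y \<longleftrightarrow> is_complex_map C f \<and> src f = X \<and> trg f = Y"
  by (auto simp: in_hom_def C_inf_def is_complex_map_def)

lemma category_C_inf:
  fixes C :: "('o, 'm) cat"
  assumes "category C"
  shows "category (C_inf C)"
proof -
  interpret category C by fact
  have sel: "Ident (C_inf C) X = \<lparr>src = X, trg = X, part = (\<lambda>i. Ident C (ob X i))\<rparr>"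
    "Comp (C_inf C) g f =
       \<lparr>src = src f, trg = trg g, part = (\<lambda>i. Comp C (part g i) (part f i))\<rparr>"
    "Obj (C_inf C) = {X. is_complex C X}" "Arr (C_inf C) = {f. is_complex_map C f}"
    "Dom (C_inf C) = src" "Cod (C_inf C) = trg" for X g f
    by (simp_all add: C_inf_def)
  show ?thesis
  proof (unfold_locales, unfold in_hom_C_inf sel)
    fix f assume "f \<in> {f. is_complex_map C f}"
    then show "src f \<in> {X. is_complex C X} \<and> trg f \<in> {X. is_complex C X}"
      by (auto simp: is_complex_map_def)
  next
    fix X assume "X \<in> {X. is_complex C X}"
    then have X: "in_hom C (diff X n) (ob X n) (ob X (n + 1))" for n
      by (auto simp: is_complex_def)
    then have "ob X n \<in> Obj C" for n
      by (auto simp: in_hom_def)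
    with X show "is_complex_map C \<lparr>src = X, trg = X, part = (\<lambda>i. Ident C (ob X i))\<rparr> \<and>
        src \<lparr>src = X, trg = X, part = (\<lambda>i. Ident C (ob X i))\<rparr> = X \<and>
        trg \<lparr>src = X, trg = X, part = (\<lambda>i. Ident C (ob X i))\<rparr> = X"
      by (simp add: is_complex_map_def is_complex_def id_in_hom comp_id_left[OF X] comp_id_right[OF X])
  next
    fix f g :: "('o, 'm) cpx_map" and X Y Z
    assume fg: "is_complex_map C f \<and> src f = X \<and> trg f = Y"
      "is_complex_map C g \<and> src g = Y \<and> trg g = Z"
    have f: "in_hom C (part f i) (ob X i) (ob Y i)"
      and g: "in_hom C (part g i) (ob Y i) (ob Z i)"
      and dX: "in_hom C (diff X i) (ob X i) (ob X (i + 1))"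
      and dY: "in_hom C (diff Y i) (ob Y i) (ob Y (i + 1))"
      and dZ: "in_hom C (diff Z i) (ob Z i) (ob Z (i + 1))"
      and cf: "Comp C (diff Y i) (part f i) = Comp C (part f (i + 1)) (diff X i)"
      and cg: "Comp C (diff Z i) (part g i) = Comp C (part g (i + 1)) (diff Y i)" for i
      using fg by (auto simp: is_complex_map_def is_complex_def)
    have "Comp C (diff Z i) (Comp C (part g i) (part f i)) =
          Comp C (Comp C (part g (i + 1)) (part f (i + 1))) (diff X i)" for i
      using comp_assoc[OF f g dZ, of i] comp_assoc[OF f dY g, of i] comp_assoc[OF dX f g, of i]
        cf[of i] cg[of i] by simp
    moreover have "in_hom C (Comp C (part g i) (part f i)) (ob X i) (ob Z i)" for i
      by (rule comp_in_hom[OF f g])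
    ultimately show "is_complex_map C
          \<lparr>src = src f, trg = trg g, part = (\<lambda>i. Comp C (part g i) (part f i))\<rparr> \<and>
        src \<lparr>src = src f, trg = trg g, part = (\<lambda>i. Comp C (part g i) (part f i))\<rparr> = X \<and>
        trg \<lparr>src = src f, trg = trg g, part = (\<lambda>i. Comp C (part g i) (part f i))\<rparr> = Z"
      using fg by (auto simp: is_complex_map_def)
  next
    fix f :: "('o, 'm) cpx_map" and X Y
    assume f: "is_complex_map C f \<and> src f = X \<and> trg f = Y"
    then have p: "in_hom C (part f i) (ob X i) (ob Y i)" for i
      by (auto simp: is_complex_map_def)
    show "\<lparr>src = src \<lparr>src = X, trg = X, part = (\<lambda>i. Ident C (ob X i))\<rparr>, trg = trg f,
        part = (\<lambda>i. Comp C (part f i) (part \<lparr>src = X, trg = X, part = (\<lambda>i. Ident C (ob X i))\<rparr> i))\<rparr> = f"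
      using f by (simp add: comp_id_right[OF p])
    show "\<lparr>src = src f, trg = trg \<lparr>src = Y, trg = Y, part = (\<lambda>i. Ident C (ob Y i))\<rparr>,
        part = (\<lambda>i. Comp C (part \<lparr>src = Y, trg = Y, part = (\<lambda>i. Ident C (ob Y i))\<rparr> i) (part f i))\<rparr> = f"
      using f by (simp add: comp_id_left[OF p])
  next
    fix f g h :: "('o, 'm) cpx_map" and W X Y Z
    assume "is_complex_map C f \<and> src f = W \<and> trg f = X"
      "is_complex_map C g \<and> src g = X \<and> trg g = Y"
      "is_complex_map C h \<and> src h = Y \<and> trg h = Z"
    then have "in_hom C (part f i) (ob W i) (ob X i)" "in_hom C (part g i) (ob X i) (ob Y i)"
      "in_hom C (part h i) (ob Y i) (ob Z i)" for i
      by (auto simp: is_complex_map_def)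
    then have "Comp C (part h i) (Comp C (part g i) (part f i)) =
        Comp C (Comp C (part h i) (part g i)) (part f i)" for i
      by (rule comp_assoc)
    then show "\<lparr>src = src \<lparr>src = src f, trg = trg g, part = (\<lambda>i. Comp C (part g i) (part f i))\<rparr>,
        trg = trg h,
        part = (\<lambda>i. Comp C (part h i)
          (part \<lparr>src = src f, trg = trg g, part = (\<lambda>i. Comp C (part g i) (part f i))\<rparr> i))\<rparr> =
      \<lparr>src = src f,
        trg = trg \<lparr>src = src g, trg = trg h, part = (\<lambda>i. Comp C (part h i) (part g i))\<rparr>,
        part = (\<lambda>i. Comp C
          (part \<lparr>src = src g, trg = trg h, part = (\<lambda>i. Comp C (part h i) (part g i))\<rparr> i) (part f i))\<rparr>"
      by simp
  qed
qed

lemma category_C_N: "category C \<Longrightarrow> category (C_N N C)"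
  unfolding C_N_def by (intro category_full_subcat category_C_inf)

lemma diff_pow_in_hom:
  assumes "category C" "is_complex C X"
  shows "in_hom C (diff_pow C X N n) (ob X n) (ob X (n + int N))"
proof (induction N)
  case 0
  have "ob X n \<in> Obj C"
    using assms(2) by (auto simp: is_complex_def in_hom_def)
  then show ?case
    using category.id_in_hom[OF assms(1)] by simp
next
  case (Suc N)
  have "in_hom C (diff X (n + int N)) (ob X (n + int N)) (ob X (n + int N + 1))"
    using assms(2) by (auto simp: is_complex_def)
  then show ?case
    using category.comp_in_hom[OF assms(1) Suc] by (simp add: algebra_simps)
qed

end

theory Submission
  imports Defs
begin

text \<open>
  Limits of complexes are computed degree by degree. A diagram \<open>F\<close> of complexes gives, for every
  integer \<open>n\<close>, a diagram \<open>F\<^sup>n\<close> in \<open>C\<close>, and the differentials of the complexes \<open>F j\<close> form a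
  natural transformation from \<open>F\<^sup>n\<close> to \<open>F\<^sup>n\<^sup>+\<^sup>1\<close>. Choosing a limit \<open>L\<^sup>n\<close> of each \<open>F\<^sup>n\<close>, this
  transformation induces an arrow from \<open>L\<^sup>n\<close> to \<open>L\<^sup>n\<^sup>+\<^sup>1\<close>, uniquely determined by the requirement
  that the projections commute with the differentials. As nothing is required of differentials,
  \<open>L\<close> is a complex. The arrow into \<open>L\<close> induced by a cone of complexes is found in every degree
  separately; it commutes with the differentials because arrows into \<open>L\<^sup>n\<^sup>+\<^sup>1\<close> may be compared after
  composing them with the projections (\<open>limit_C_inf_degreewise\<close>).

  For \<open>N\<close>-complexes it then suffices to see that this limit again satisfies \<open>d\<^sup>N = 0\<close>, because a
  full subcategory inherits every limit whose vertex it contains (\<open>is_limit_full_subcat\<close>). The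
  projections commute with \<open>d\<^sup>N\<close>, so after composition with them both \<open>d\<^sup>N\<close> and the zero arrow
  from \<open>L\<^sup>n\<close> to \<open>L\<^sup>n\<^sup>+\<^sup>N\<close> become zero arrows; hence they agree (\<open>zero_diff_pow_limit\<close>).

  Colimits are treated in the same way with all arrows reversed. The direct argument is given
  instead of an appeal to the opposite category, since the identification of complexes in the
  opposite category with complexes in \<open>C\<close> reverses the numbering of the degrees.
\<close>

section \<open>Arrows into a limit and out of a colimit\<close>

text \<open>The projections of a limit are jointly monic: the composites of \<open>f\<close> with them form a cone,
  through which both \<open>f\<close> and \<open>g\<close> factor.\<close>

lemma (in category) limit_arrow_eqI:
  assumes lim: "is_limit J C Fo Fa L p"
    and Fa: "\<And>u i j. in_hom J u i j \<Longrightarrow> in_hom C (Fa u) (Fo i) (Fo j)"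
    and f: "in_hom C f M L" and g: "in_hom C g M L"
    and eq: "\<And>j. j \<in> Obj J \<Longrightarrow> Comp C (p j) f = Comp C (p j) g"
  shows "f = g"
proof -
  have p: "in_hom C (p j) L (Fo j)" if "j \<in> Obj J" for j
    using lim that by (auto simp: is_limit_def is_cone_def)
  have nat: "Comp C (Fa u) (p i) = p j" if "in_hom J u i j" for u i j
    using lim that by (auto simp: is_limit_def is_cone_def)
  have "is_cone J C Fo Fa M (\<lambda>j. Comp C (p j) f)"
    unfolding is_cone_def
  proof (intro conjI allI ballI impI)
    show "M \<in> Obj C"
      using f by (simp add: in_hom_def)
    show "in_hom C (Comp C (p j) f) M (Fo j)" if "j \<in> Obj J" for j
      using comp_in_hom[OF f p] that .
    show "Comp C (Fa u) (Comp C (p i) f) = Comp C (p j) f" if u: "in_hom J u i j" for u i j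
    proof -
      have "i \<in> Obj J"
        using u by (simp add: in_hom_def)
      then show ?thesis
        using comp_assoc[OF f p Fa[OF u]] nat[OF u] by simp
    qed
  qed
  then have "\<exists>!h. in_hom C h M L \<and> (\<forall>j\<in>Obj J. Comp C (p j) h = Comp C (p j) f)"
    using lim by (auto simp: is_limit_def)
  then show ?thesis
    using f g eq[symmetric] by blast
qed

lemma (in category) colimit_arrow_eqI:
  assumes colim: "is_colimit J C Fo Fa L p"
    and Fa: "\<And>u i j. in_hom J u i j \<Longrightarrow> in_hom C (Fa u) (Fo i) (Fo j)"
    and f: "in_hom C f L M" and g: "in_hom C g L M"
    and eq: "\<And>j. j \<in> Obj J \<Longrightarrow> Comp C f (p j) = Comp C g (p j)"
  shows "f = g"
proof -
  have p: "in_hom C (p j) (Fo j) L" if "j \<in> Obj J" for j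
    using colim that by (auto simp: is_colimit_def is_cocone_def)
  have nat: "Comp C (p j) (Fa u) = p i" if "in_hom J u i j" for u i j
    using colim that by (auto simp: is_colimit_def is_cocone_def)
  have "is_cocone J C Fo Fa M (\<lambda>j. Comp C f (p j))"
    unfolding is_cocone_def
  proof (intro conjI allI ballI impI)
    show "M \<in> Obj C"
      using f by (simp add: in_hom_def)
    show "in_hom C (Comp C f (p j)) (Fo j) M" if "j \<in> Obj J" for j
      using comp_in_hom[OF p f] that .
    show "Comp C (Comp C f (p j)) (Fa u) = Comp C f (p i)" if u: "in_hom J u i j" for u i j
    proof -
      have "j \<in> Obj J"
        using u by (simp add: in_hom_def)
      then show ?thesis
        using comp_assoc[OF Fa[OF u] p f] nat[OF u] by simp
    qed
  qed
  then have "\<exists>!h. in_hom C h L M \<and> (\<forall>j\<in>Obj J. Comp C h (p j) = Comp C f (p j))"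
    using colim by (auto simp: is_colimit_def)
  then show ?thesis
    using f g eq[symmetric] by blast
qed


section \<open>Limits and colimits in a full subcategory\<close>

lemma in_hom_full_subcat:
  "in_hom (full_subcat C S) f X Y \<longleftrightarrow> in_hom C f X Y \<and> X \<in> S \<and> Y \<in> S"
  by (auto simp: in_hom_def full_subcat_def)

lemma sel_full_subcat:
  "Comp (full_subcat C S) = Comp C" "Ident (full_subcat C S) = Ident C"
  "Obj (full_subcat C S) = Obj C \<inter> S"
  by (simp_all add: full_subcat_def)

lemma is_functor_full_subcat:
  "is_functor J (full_subcat C S) Fo Fa \<longleftrightarrow>
     is_functor J C Fo Fa \<and> (\<forall>j\<in>Obj J. Fo j \<in> S)"
  by (auto simp: is_functor_def in_hom_full_subcat sel_full_subcat) (auto simp: in_hom_def)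

lemma is_cone_full_subcat:
  assumes "\<And>j. j \<in> Obj J \<Longrightarrow> Fo j \<in> S"
  shows "is_cone J (full_subcat C S) Fo Fa L p \<longleftrightarrow> is_cone J C Fo Fa L p \<and> L \<in> S"
  using assms by (auto simp: is_cone_def in_hom_full_subcat sel_full_subcat)

lemma is_cocone_full_subcat:
  assumes "\<And>j. j \<in> Obj J \<Longrightarrow> Fo j \<in> S"
  shows "is_cocone J (full_subcat C S) Fo Fa L p \<longleftrightarrow> is_cocone J C Fo Fa L p \<and> L \<in> S"
  using assms by (auto simp: is_cocone_def in_hom_full_subcat sel_full_subcat)

lemma is_limit_full_subcat:
  assumes "\<And>j. j \<in> Obj J \<Longrightarrow> Fo j \<in> S" and "L \<in> S" and "is_limit J C Fo Fa L p"
  shows "is_limit J (full_subcat C S) Fo Fa L p"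
  using assms
  by (simp add: is_limit_def is_cone_full_subcat in_hom_full_subcat sel_full_subcat)

lemma is_colimit_full_subcat:
  assumes "\<And>j. j \<in> Obj J \<Longrightarrow> Fo j \<in> S" and "L \<in> S" and "is_colimit J C Fo Fa L p"
  shows "is_colimit J (full_subcat C S) Fo Fa L p"
  using assms
  by (simp add: is_colimit_def is_cocone_full_subcat in_hom_full_subcat sel_full_subcat)


section \<open>Zero arrows\<close>

text \<open>Two zero arrows may be given by different zero objects. The unique arrow between these
  identifies the two factorizations.\<close>

lemma (in category) zero_arrow_unique:
  assumes "zero_arrow C f" "zero_arrow C g" "in_hom C f X Y" "in_hom C g X Y"
  shows "f = g"
proof -
  obtain Z a b where Z: "zero_object C Z" and a: "in_hom C a X Z" and b: "in_hom C b Z Y"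
    and f: "f = Comp C b a"
    using assms(1,3) by (auto simp: zero_arrow_def in_hom_def)
  obtain Z' a' b' where Z': "zero_object C Z'" and a': "in_hom C a' X Z'"
    and b': "in_hom C b' Z' Y" and g: "g = Comp C b' a'"
    using assms(2,4) by (auto simp: zero_arrow_def in_hom_def)
  obtain t where t: "in_hom C t Z Z'"
    using Z Z' by (auto simp: zero_object_def)
  have X: "X \<in> Obj C" and Y: "Y \<in> Obj C"
    using a b by (auto simp: in_hom_def)
  have "Comp C t a = a'"
    using comp_in_hom[OF a t] a' Z' X unfolding zero_object_def by blast
  moreover have "Comp C b' t = b"
    using comp_in_hom[OF t b'] b Z Y unfolding zero_object_def by blast
  ultimately show ?thesis
    using comp_assoc[OF a t b'] f g by simp
qed

lemma (in category) zero_arrowI: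
  assumes "zero_object C Z" "in_hom C a X Z" "in_hom C b Z Y"
  shows "zero_arrow C (Comp C b a)"
  using assms comp_in_hom[OF assms(2,3)] by (auto simp: zero_arrow_def in_hom_def)

lemma (in category) zero_arrow_exists:
  assumes "pointed C" "X \<in> Obj C" "Y \<in> Obj C"
  obtains z where "zero_arrow C z" "in_hom C z X Y"
proof -
  obtain Z where Z: "zero_object C Z"
    using assms(1) by (auto simp: pointed_def)
  obtain a where a: "in_hom C a X Z"
    using Z assms(2) by (auto simp: zero_object_def)
  obtain b where b: "in_hom C b Z Y"
    using Z assms(3) by (auto simp: zero_object_def)
  have "in_hom C (Comp C b a) X Y"
    using comp_in_hom[OF a b] .
  then show thesis
    using that zero_arrowI[OF Z a b] by blast
qed

lemma (in category) zero_arrow_comp_left: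
  assumes "zero_arrow C f" "in_hom C f X Y" "in_hom C g Y W"
  shows "zero_arrow C (Comp C g f)"
proof -
  obtain Z a b where Z: "zero_object C Z" and a: "in_hom C a X Z" and b: "in_hom C b Z Y"
    and f: "f = Comp C b a"
    using assms(1,2) by (auto simp: zero_arrow_def in_hom_def)
  have "Comp C g f = Comp C (Comp C g b) a"
    using comp_assoc[OF a b assms(3)] f by simp
  then show ?thesis
    using Z a comp_in_hom[OF b assms(3)] zero_arrowI by metis
qed

lemma (in category) zero_arrow_comp_right:
  assumes "zero_arrow C g" "in_hom C g Y W" "in_hom C f X Y"
  shows "zero_arrow C (Comp C g f)"
proof -
  obtain Z a b where Z: "zero_object C Z" and a: "in_hom C a Y Z" and b: "in_hom C b Z W"
    and g: "g = Comp C b a"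
    using assms(1,2) by (auto simp: zero_arrow_def in_hom_def)
  have "Comp C g f = Comp C b (Comp C a f)"
    using comp_assoc[OF assms(3) a b] g by simp
  then show ?thesis
    using Z b comp_in_hom[OF assms(3) a] zero_arrowI by metis
qed


section \<open>Diagrams of complexes, degree by degree\<close>

lemma C_inf_simps:
  "Obj (C_inf C) = {X. is_complex C X}"
  "Ident (C_inf C) X = \<lparr>src = X, trg = X, part = (\<lambda>i. Ident C (ob X i))\<rparr>"
  "Comp (C_inf C) g f =
     \<lparr>src = src f, trg = trg g, part = (\<lambda>i. Comp C (part g i) (part f i))\<rparr>"
  by (simp_all add: C_inf_def)

lemma complex_map_in_hom: "is_complex_map C f \<Longrightarrow> in_hom C (part f n) (ob (src f) n) (ob (trg f) n)"
  by (simp add: is_complex_map_def)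

lemma complex_in_hom: "is_complex C X \<Longrightarrow> in_hom C (diff X n) (ob X n) (ob X (n + 1))"
  by (simp add: is_complex_def)

lemma complex_ob: "is_complex C X \<Longrightarrow> ob X n \<in> Obj C"
  using complex_in_hom by (fastforce simp: in_hom_def)

lemma complex_map_comm:
  "is_complex_map C f \<Longrightarrow>
     Comp C (diff (trg f) n) (part f n) = Comp C (part f (n + 1)) (diff (src f) n)"
  by (simp add: is_complex_map_def)

lemma functor_C_inf_Fo: "is_functor J (C_inf C) Fo Fa \<Longrightarrow> j \<in> Obj J \<Longrightarrow> is_complex C (Fo j)"
  by (auto simp: is_functor_def C_inf_simps)

lemma functor_C_inf_Fa:
  "is_functor J (C_inf C) Fo Fa \<Longrightarrow> in_hom J u i j \<Longrightarrow>
     is_complex_map C (Fa u) \<and> src (Fa u) = Fo i \<and> trg (Fa u) = Fo j"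
  by (auto simp: is_functor_def in_hom_C_inf)

lemma is_functor_degree:
  assumes "is_functor J (C_inf C) Fo Fa"
  shows "is_functor J C (\<lambda>j. ob (Fo j) n) (\<lambda>u. part (Fa u) n)"
  unfolding is_functor_def
proof (intro conjI allI ballI impI)
  note Fo = functor_C_inf_Fo[OF assms] and Fa = functor_C_inf_Fa[OF assms]
  show "ob (Fo j) n \<in> Obj C" if "j \<in> Obj J" for j
    using complex_ob[OF Fo[OF that]] .
  show "in_hom C (part (Fa u) n) (ob (Fo i) n) (ob (Fo j) n)" if "in_hom J u i j" for u i j
    using Fa[OF that] complex_map_in_hom by metis
  show "part (Fa (Ident J j)) n = Ident C (ob (Fo j) n)" if "j \<in> Obj J" for j
    using assms that by (simp add: is_functor_def C_inf_simps)
  show "part (Fa (Comp J v u)) n = Comp C (part (Fa v) n) (part (Fa u) n)"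
    if "in_hom J u i j \<and> in_hom J v j k" for u v i j k
  proof -
    have "Fa (Comp J v u) = Comp (C_inf C) (Fa v) (Fa u)"
      using assms that unfolding is_functor_def by blast
    then show ?thesis
      by (simp add: C_inf_simps)
  qed
qed

lemma is_cone_C_inf:
  assumes F: "is_functor J (C_inf C) Fo Fa"
  shows "is_cone J (C_inf C) Fo Fa L p \<longleftrightarrow>
     is_complex C L \<and>
     (\<forall>j\<in>Obj J. is_complex_map C (p j) \<and> src (p j) = L \<and> trg (p j) = Fo j) \<and>
     (\<forall>n. is_cone J C (\<lambda>j. ob (Fo j) n) (\<lambda>u. part (Fa u) n) (ob L n) (\<lambda>j. part (p j) n))"
    (is "?l \<longleftrightarrow> ?r")
proof
  assume l: ?l
  then have L: "is_complex C L"
    and p: "\<And>j. j \<in> Obj J \<Longrightarrow> is_complex_map C (p j) \<and> src (p j) = L \<and> trg (p j) = Fo j"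
    and nat: "\<And>u i j. in_hom J u i j \<Longrightarrow> Comp (C_inf C) (Fa u) (p i) = p j"
    unfolding is_cone_def in_hom_C_inf C_inf_simps(1) by auto
  have "Comp C (part (Fa u) n) (part (p i) n) = part (p j) n" if "in_hom J u i j" for u i j n
    using nat[OF that, symmetric] by (simp add: C_inf_simps)
  then show ?r
    using L p complex_map_in_hom by (fastforce simp: is_cone_def complex_ob)
next
  assume r: ?r
  have "Comp (C_inf C) (Fa u) (p i) = p j" if u: "in_hom J u i j" for u i j
  proof -
    have ij: "i \<in> Obj J" "j \<in> Obj J"
      using u by (auto simp: in_hom_def)
    have "Comp C (part (Fa u) n) (part (p i) n) = part (p j) n" for n
      using r u by (auto simp: is_cone_def)
    then show ?thesis
      using r ij functor_C_inf_Fa[OF F u] by (simp add: C_inf_simps)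
  qed
  with r show ?l
    unfolding is_cone_def in_hom_C_inf C_inf_simps(1) by auto
qed

lemma is_cocone_C_inf:
  assumes F: "is_functor J (C_inf C) Fo Fa"
  shows "is_cocone J (C_inf C) Fo Fa L p \<longleftrightarrow>
     is_complex C L \<and>
     (\<forall>j\<in>Obj J. is_complex_map C (p j) \<and> src (p j) = Fo j \<and> trg (p j) = L) \<and>
     (\<forall>n. is_cocone J C (\<lambda>j. ob (Fo j) n) (\<lambda>u. part (Fa u) n) (ob L n) (\<lambda>j. part (p j) n))"
    (is "?l \<longleftrightarrow> ?r")
proof
  assume l: ?l
  then have L: "is_complex C L"
    and p: "\<And>j. j \<in> Obj J \<Longrightarrow> is_complex_map C (p j) \<and> src (p j) = Fo j \<and> trg (p j) = L"
    and nat: "\<And>u i j. in_hom J u i j \<Longrightarrow> Comp (C_inf C) (p j) (Fa u) = p i"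
    unfolding is_cocone_def in_hom_C_inf C_inf_simps(1) by auto
  have "Comp C (part (p j) n) (part (Fa u) n) = part (p i) n" if "in_hom J u i j" for u i j n
    using nat[OF that, symmetric] by (simp add: C_inf_simps)
  then show ?r
    using L p complex_map_in_hom by (fastforce simp: is_cocone_def complex_ob)
next
  assume r: ?r
  have "Comp (C_inf C) (p j) (Fa u) = p i" if u: "in_hom J u i j" for u i j
  proof -
    have ij: "i \<in> Obj J" "j \<in> Obj J"
      using u by (auto simp: in_hom_def)
    have "Comp C (part (p j) n) (part (Fa u) n) = part (p i) n" for n
      using r u by (auto simp: is_cocone_def)
    then show ?thesis
      using r ij functor_C_inf_Fa[OF F u] by (simp add: C_inf_simps)
  qed
  with r show ?l
    unfolding is_cocone_def in_hom_C_inf C_inf_simps(1) by auto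
qed


section \<open>Limits and colimits of complexes\<close>

text \<open>The existence of differentials and the factorization of cones both come from the universal
  property in a single degree; that the resulting arrows fit together across degrees comes from its
  uniqueness part.\<close>

lemma (in category) limit_C_inf_degreewise:
  assumes F: "is_functor J (C_inf C) Fo Fa"
    and lim: "\<And>n. is_limit J C (\<lambda>j. ob (Fo j) n) (\<lambda>u. part (Fa u) n) (l n) (\<pi> n)"
  obtains L where "ob L = l"
    and "is_limit J (C_inf C) Fo Fa L (\<lambda>j. \<lparr>src = L, trg = Fo j, part = (\<lambda>n. \<pi> n j)\<rparr>)"
proof -
  have Fa: "in_hom C (part (Fa u) n) (ob (Fo i) n) (ob (Fo j) n)" if "in_hom J u i j" for u i j n
    using functor_C_inf_Fa[OF F that] complex_map_in_hom by metis
  have \<pi>: "in_hom C (\<pi> n j) (l n) (ob (Fo j) n)" if "j \<in> Obj J" for n j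
    using lim[of n] that by (auto simp: is_limit_def is_cone_def)
  have nat: "Comp C (part (Fa u) n) (\<pi> n i) = \<pi> n j" if "in_hom J u i j" for u i j n
    using lim[of n] that by (auto simp: is_limit_def is_cone_def)
  have dF: "in_hom C (diff (Fo j) n) (ob (Fo j) n) (ob (Fo j) (n + 1))" if "j \<in> Obj J" for j n
    using complex_in_hom[OF functor_C_inf_Fo[OF F that]] .

  have "is_cone J C (\<lambda>j. ob (Fo j) (n + 1)) (\<lambda>u. part (Fa u) (n + 1)) (l n)
          (\<lambda>j. Comp C (diff (Fo j) n) (\<pi> n j))" for n
    unfolding is_cone_def
  proof (intro conjI allI ballI impI)
    show "l n \<in> Obj C"
      using lim[of n] by (auto simp: is_limit_def is_cone_def)
    show "in_hom C (Comp C (diff (Fo j) n) (\<pi> n j)) (l n) (ob (Fo j) (n + 1))"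
      if "j \<in> Obj J" for j
      using comp_in_hom[OF \<pi> dF] that by blast
    fix u i j assume u: "in_hom J u i j"
    then have ij: "i \<in> Obj J" "j \<in> Obj J"
      by (auto simp: in_hom_def)
    have "Comp C (part (Fa u) (n + 1)) (Comp C (diff (Fo i) n) (\<pi> n i)) =
          Comp C (Comp C (diff (Fo j) n) (part (Fa u) n)) (\<pi> n i)"
      using comp_assoc[OF \<pi>[OF ij(1)] dF[OF ij(1)] Fa[OF u]] functor_C_inf_Fa[OF F u]
        complex_map_comm[of C "Fa u" n] by simp
    also have "\<dots> = Comp C (diff (Fo j) n) (\<pi> n j)"
      using comp_assoc[OF \<pi>[OF ij(1)] Fa[OF u] dF[OF ij(2)]] nat[OF u] by simp
    finally show "Comp C (part (Fa u) (n + 1)) (Comp C (diff (Fo i) n) (\<pi> n i)) =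
          Comp C (diff (Fo j) n) (\<pi> n j)" .
  qed
  then have "\<exists>h. in_hom C h (l n) (l (n + 1)) \<and>
      (\<forall>j\<in>Obj J. Comp C (\<pi> (n + 1) j) h = Comp C (diff (Fo j) n) (\<pi> n j))" for n
    using lim[of "n + 1"] unfolding is_limit_def by blast
  then obtain d where d: "\<And>n. in_hom C (d n) (l n) (l (n + 1))"
    and \<pi>d: "\<And>n j. j \<in> Obj J \<Longrightarrow>
      Comp C (\<pi> (n + 1) j) (d n) = Comp C (diff (Fo j) n) (\<pi> n j)"
    by metis
  define L where "L = \<lparr>ob = l, diff = d\<rparr>"
  let ?p = "\<lambda>j. \<lparr>src = L, trg = Fo j, part = (\<lambda>n. \<pi> n j)\<rparr>"
  have L: "is_complex C L" "ob L = l" "diff L = d"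
    using d by (auto simp: L_def is_complex_def)
  have p: "is_complex_map C (?p j)" if "j \<in> Obj J" for j
    using L \<pi> \<pi>d functor_C_inf_Fo[OF F] that by (simp add: is_complex_map_def)
  have cone: "is_cone J (C_inf C) Fo Fa L ?p"
    using p lim L by (simp add: is_cone_C_inf[OF F] is_limit_def)
  have "\<exists>!h. in_hom (C_inf C) h M L \<and> (\<forall>j\<in>Obj J. Comp (C_inf C) (?p j) h = q j)"
    if "is_cone J (C_inf C) Fo Fa M q" for M q
  proof -
    have M: "is_complex C M"
      and q: "\<And>j. j \<in> Obj J \<Longrightarrow> is_complex_map C (q j) \<and> src (q j) = M \<and> trg (q j) = Fo j"
      and qn: "\<And>n. is_cone J C (\<lambda>j. ob (Fo j) n) (\<lambda>u. part (Fa u) n) (ob M n) (\<lambda>j. part (q j) n)"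
      using that by (auto simp: is_cone_C_inf[OF F])
    have "\<exists>h. in_hom C h (ob M n) (l n) \<and> (\<forall>j\<in>Obj J. Comp C (\<pi> n j) h = part (q j) n)" for n
      using lim[of n] qn[of n] unfolding is_limit_def by blast
    then obtain h where h: "\<And>n. in_hom C (h n) (ob M n) (l n)"
      and \<pi>h: "\<And>n j. j \<in> Obj J \<Longrightarrow> Comp C (\<pi> n j) (h n) = part (q j) n"
      by metis
    have dM: "in_hom C (diff M n) (ob M n) (ob M (n + 1))" for n
      using complex_in_hom[OF M] .
    have "Comp C (d n) (h n) = Comp C (h (n + 1)) (diff M n)" for n
    proof (rule limit_arrow_eqI[OF lim Fa])
      show "in_hom C (Comp C (d n) (h n)) (ob M n) (l (n + 1))"
        using comp_in_hom[OF h d] .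
      show "in_hom C (Comp C (h (n + 1)) (diff M n)) (ob M n) (l (n + 1))"
        using comp_in_hom[OF dM h] .
      fix j assume j: "j \<in> Obj J"
      have "Comp C (\<pi> (n + 1) j) (Comp C (d n) (h n)) =
            Comp C (diff (Fo j) n) (Comp C (\<pi> n j) (h n))"
        using comp_assoc[OF h d \<pi>[OF j]] comp_assoc[OF h \<pi>[OF j] dF[OF j]] \<pi>d[OF j] by simp
      also have "\<dots> = Comp C (part (q j) (n + 1)) (diff M n)"
        using \<pi>h[OF j] q[OF j] complex_map_comm[of C "q j" n] by simp
      also have "\<dots> = Comp C (\<pi> (n + 1) j) (Comp C (h (n + 1)) (diff M n))"
        using comp_assoc[OF dM h \<pi>[OF j]] \<pi>h[OF j] by simp
      finally show "Comp C (\<pi> (n + 1) j) (Comp C (d n) (h n)) =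
            Comp C (\<pi> (n + 1) j) (Comp C (h (n + 1)) (diff M n))" .
    qed
    then have "is_complex_map C \<lparr>src = M, trg = L, part = h\<rparr>"
      using M L h by (simp add: is_complex_map_def)
    then show ?thesis
    proof (intro ex1I[of _ "\<lparr>src = M, trg = L, part = h\<rparr>"] conjI ballI)
      show "in_hom (C_inf C) \<lparr>src = M, trg = L, part = h\<rparr> M L"
        if "is_complex_map C \<lparr>src = M, trg = L, part = h\<rparr>"
        using that by (simp add: in_hom_C_inf)
      show "Comp (C_inf C) (?p j) \<lparr>src = M, trg = L, part = h\<rparr> = q j" if "j \<in> Obj J" for j
        using \<pi>h[OF that] q[OF that] by (auto simp: C_inf_simps)
      fix k
      assume k: "in_hom (C_inf C) k M L \<and> (\<forall>j\<in>Obj J. Comp (C_inf C) (?p j) k = q j)"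
      have "part k n = h n" for n
      proof (rule limit_arrow_eqI[OF lim Fa])
        show "in_hom C (part k n) (ob M n) (l n)"
          using k complex_map_in_hom[of C k n] L by (simp add: in_hom_C_inf)
        show "in_hom C (h n) (ob M n) (l n)"
          by (rule h)
        fix j assume j: "j \<in> Obj J"
        with k have "part (Comp (C_inf C) (?p j) k) n = part (q j) n"
          by simp
        then show "Comp C (\<pi> n j) (part k n) = Comp C (\<pi> n j) (h n)"
          using \<pi>h[OF j] by (simp add: C_inf_simps)
      qed
      then have "part k = h"
        by (rule ext)
      then show "k = \<lparr>src = M, trg = L, part = h\<rparr>"
        using k by (auto simp: in_hom_C_inf)
    qed
  qed
  with cone have "is_limit J (C_inf C) Fo Fa L ?p"
    by (simp add: is_limit_def)
  with L show thesis
    using that by blast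
qed

lemma (in category) colimit_C_inf_degreewise:
  assumes F: "is_functor J (C_inf C) Fo Fa"
    and colim: "\<And>n. is_colimit J C (\<lambda>j. ob (Fo j) n) (\<lambda>u. part (Fa u) n) (l n) (\<iota> n)"
  obtains L where "ob L = l"
    and "is_colimit J (C_inf C) Fo Fa L (\<lambda>j. \<lparr>src = Fo j, trg = L, part = (\<lambda>n. \<iota> n j)\<rparr>)"
proof -
  have Fa: "in_hom C (part (Fa u) n) (ob (Fo i) n) (ob (Fo j) n)" if "in_hom J u i j" for u i j n
    using functor_C_inf_Fa[OF F that] complex_map_in_hom by metis
  have \<iota>: "in_hom C (\<iota> n j) (ob (Fo j) n) (l n)" if "j \<in> Obj J" for n j
    using colim[of n] that by (auto simp: is_colimit_def is_cocone_def)
  have nat: "Comp C (\<iota> n j) (part (Fa u) n) = \<iota> n i" if "in_hom J u i j" for u i j n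
    using colim[of n] that by (auto simp: is_colimit_def is_cocone_def)
  have dF: "in_hom C (diff (Fo j) n) (ob (Fo j) n) (ob (Fo j) (n + 1))" if "j \<in> Obj J" for j n
    using complex_in_hom[OF functor_C_inf_Fo[OF F that]] .

  have "is_cocone J C (\<lambda>j. ob (Fo j) n) (\<lambda>u. part (Fa u) n) (l (n + 1))
          (\<lambda>j. Comp C (\<iota> (n + 1) j) (diff (Fo j) n))" for n
    unfolding is_cocone_def
  proof (intro conjI allI ballI impI)
    show "l (n + 1) \<in> Obj C"
      using colim[of "n + 1"] by (auto simp: is_colimit_def is_cocone_def)
    show "in_hom C (Comp C (\<iota> (n + 1) j) (diff (Fo j) n)) (ob (Fo j) n) (l (n + 1))"
      if "j \<in> Obj J" for j
      using comp_in_hom[OF dF \<iota>] that by blast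
    fix u i j assume u: "in_hom J u i j"
    then have ij: "i \<in> Obj J" "j \<in> Obj J"
      by (auto simp: in_hom_def)
    have "Comp C (Comp C (\<iota> (n + 1) j) (diff (Fo j) n)) (part (Fa u) n) =
          Comp C (\<iota> (n + 1) j) (Comp C (part (Fa u) (n + 1)) (diff (Fo i) n))"
      using comp_assoc[OF Fa[OF u] dF[OF ij(2)] \<iota>[OF ij(2)], of n, symmetric] functor_C_inf_Fa[OF F u]
        complex_map_comm[of C "Fa u" n] by simp
    also have "\<dots> = Comp C (\<iota> (n + 1) i) (diff (Fo i) n)"
      using comp_assoc[OF dF[OF ij(1)] Fa[OF u] \<iota>[OF ij(2)]] nat[OF u] by simp
    finally show "Comp C (Comp C (\<iota> (n + 1) j) (diff (Fo j) n)) (part (Fa u) n) =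
          Comp C (\<iota> (n + 1) i) (diff (Fo i) n)" .
  qed
  then have "\<exists>h. in_hom C h (l n) (l (n + 1)) \<and>
      (\<forall>j\<in>Obj J. Comp C h (\<iota> n j) = Comp C (\<iota> (n + 1) j) (diff (Fo j) n))" for n
    using colim[of n] unfolding is_colimit_def by blast
  then obtain d where d: "\<And>n. in_hom C (d n) (l n) (l (n + 1))"
    and d\<iota>: "\<And>n j. j \<in> Obj J \<Longrightarrow>
      Comp C (d n) (\<iota> n j) = Comp C (\<iota> (n + 1) j) (diff (Fo j) n)"
    by metis
  define L where "L = \<lparr>ob = l, diff = d\<rparr>"
  let ?p = "\<lambda>j. \<lparr>src = Fo j, trg = L, part = (\<lambda>n. \<iota> n j)\<rparr>"
  have L: "is_complex C L" "ob L = l" "diff L = d"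
    using d by (auto simp: L_def is_complex_def)
  have p: "is_complex_map C (?p j)" if "j \<in> Obj J" for j
    using L \<iota> d\<iota> functor_C_inf_Fo[OF F] that by (simp add: is_complex_map_def)
  have cocone: "is_cocone J (C_inf C) Fo Fa L ?p"
    using p colim L by (simp add: is_cocone_C_inf[OF F] is_colimit_def)
  have "\<exists>!h. in_hom (C_inf C) h L M \<and> (\<forall>j\<in>Obj J. Comp (C_inf C) h (?p j) = q j)"
    if "is_cocone J (C_inf C) Fo Fa M q" for M q
  proof -
    have M: "is_complex C M"
      and q: "\<And>j. j \<in> Obj J \<Longrightarrow> is_complex_map C (q j) \<and> src (q j) = Fo j \<and> trg (q j) = M"
      and qn: "\<And>n. is_cocone J C (\<lambda>j. ob (Fo j) n) (\<lambda>u. part (Fa u) n) (ob M n) (\<lambda>j. part (q j) n)"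
      using that by (auto simp: is_cocone_C_inf[OF F])
    have "\<exists>h. in_hom C h (l n) (ob M n) \<and> (\<forall>j\<in>Obj J. Comp C h (\<iota> n j) = part (q j) n)" for n
      using colim[of n] qn[of n] unfolding is_colimit_def by blast
    then obtain h where h: "\<And>n. in_hom C (h n) (l n) (ob M n)"
      and h\<iota>: "\<And>n j. j \<in> Obj J \<Longrightarrow> Comp C (h n) (\<iota> n j) = part (q j) n"
      by metis
    have dM: "in_hom C (diff M n) (ob M n) (ob M (n + 1))" for n
      using complex_in_hom[OF M] .
    have "Comp C (diff M n) (h n) = Comp C (h (n + 1)) (d n)" for n
    proof (rule colimit_arrow_eqI[OF colim Fa])
      show "in_hom C (Comp C (diff M n) (h n)) (l n) (ob M (n + 1))"
        using comp_in_hom[OF h dM] .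
      show "in_hom C (Comp C (h (n + 1)) (d n)) (l n) (ob M (n + 1))"
        using comp_in_hom[OF d h] .
      fix j assume j: "j \<in> Obj J"
      have "Comp C (Comp C (diff M n) (h n)) (\<iota> n j) = Comp C (diff M n) (part (q j) n)"
        using comp_assoc[OF \<iota>[OF j] h dM] h\<iota>[OF j] by simp
      also have "\<dots> = Comp C (Comp C (h (n + 1)) (\<iota> (n + 1) j)) (diff (Fo j) n)"
        using h\<iota>[OF j] q[OF j] complex_map_comm[of C "q j" n] by simp
      also have "\<dots> = Comp C (Comp C (h (n + 1)) (d n)) (\<iota> n j)"
        using comp_assoc[OF \<iota>[OF j] d h] comp_assoc[OF dF[OF j] \<iota>[OF j] h] d\<iota>[OF j] by simp
      finally show "Comp C (Comp C (diff M n) (h n)) (\<iota> n j) =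
            Comp C (Comp C (h (n + 1)) (d n)) (\<iota> n j)" .
    qed
    then have "is_complex_map C \<lparr>src = L, trg = M, part = h\<rparr>"
      using M L h by (simp add: is_complex_map_def)
    then show ?thesis
    proof (intro ex1I[of _ "\<lparr>src = L, trg = M, part = h\<rparr>"] conjI ballI)
      show "in_hom (C_inf C) \<lparr>src = L, trg = M, part = h\<rparr> L M"
        if "is_complex_map C \<lparr>src = L, trg = M, part = h\<rparr>"
        using that by (simp add: in_hom_C_inf)
      show "Comp (C_inf C) \<lparr>src = L, trg = M, part = h\<rparr> (?p j) = q j" if "j \<in> Obj J" for j
        using h\<iota>[OF that] q[OF that] by (auto simp: C_inf_simps)
      fix k
      assume k: "in_hom (C_inf C) k L M \<and> (\<forall>j\<in>Obj J. Comp (C_inf C) k (?p j) = q j)"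
      have "part k n = h n" for n
      proof (rule colimit_arrow_eqI[OF colim Fa])
        show "in_hom C (part k n) (l n) (ob M n)"
          using k complex_map_in_hom[of C k n] L by (simp add: in_hom_C_inf)
        show "in_hom C (h n) (l n) (ob M n)"
          by (rule h)
        fix j assume j: "j \<in> Obj J"
        with k have "part (Comp (C_inf C) k (?p j)) n = part (q j) n"
          by simp
        then show "Comp C (part k n) (\<iota> n j) = Comp C (h n) (\<iota> n j)"
          using h\<iota>[OF j] by (simp add: C_inf_simps)
      qed
      then have "part k = h"
        by (rule ext)
      then show "k = \<lparr>src = L, trg = M, part = h\<rparr>"
        using k by (auto simp: in_hom_C_inf)
    qed
  qed
  with cocone have "is_colimit J (C_inf C) Fo Fa L ?p"
    by (simp add: is_colimit_def)
  with L show thesis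
    using that by blast
qed

text \<open>The degreewise description is kept in the conclusion, because for \<open>N\<close>-complexes arrows into
  the components of the limit have to be compared.\<close>

lemma (in category) has_limits_degreewise:
  assumes "has_limits U C" "small_category U J" and F: "is_functor J (C_inf C) Fo Fa"
  obtains L p where "is_limit J (C_inf C) Fo Fa L p"
    and "\<And>n. is_limit J C (\<lambda>j. ob (Fo j) n) (\<lambda>u. part (Fa u) n) (ob L n) (\<lambda>j. part (p j) n)"
proof -
  have "\<exists>l \<pi>. is_limit J C (\<lambda>j. ob (Fo j) n) (\<lambda>u. part (Fa u) n) l \<pi>" for n
    using assms is_functor_degree[OF F] by (simp add: has_limits_def)
  then obtain l \<pi> where
    lim: "\<And>n. is_limit J C (\<lambda>j. ob (Fo j) n) (\<lambda>u. part (Fa u) n) (l n) (\<pi> n)"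
    by metis
  obtain L where "ob L = l"
    and "is_limit J (C_inf C) Fo Fa L (\<lambda>j. \<lparr>src = L, trg = Fo j, part = (\<lambda>n. \<pi> n j)\<rparr>)"
    using limit_C_inf_degreewise[OF F lim] .
  then show thesis
    using lim by (intro that) auto
qed

lemma (in category) has_colimits_degreewise:
  assumes "has_colimits U C" "small_category U J" and F: "is_functor J (C_inf C) Fo Fa"
  obtains L p where "is_colimit J (C_inf C) Fo Fa L p"
    and "\<And>n. is_colimit J C (\<lambda>j. ob (Fo j) n) (\<lambda>u. part (Fa u) n) (ob L n) (\<lambda>j. part (p j) n)"
proof -
  have "\<exists>l \<iota>. is_colimit J C (\<lambda>j. ob (Fo j) n) (\<lambda>u. part (Fa u) n) l \<iota>" for n
    using assms is_functor_degree[OF F] by (simp add: has_colimits_def)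
  then obtain l \<iota> where
    colim: "\<And>n. is_colimit J C (\<lambda>j. ob (Fo j) n) (\<lambda>u. part (Fa u) n) (l n) (\<iota> n)"
    by metis
  obtain L where "ob L = l"
    and "is_colimit J (C_inf C) Fo Fa L (\<lambda>j. \<lparr>src = Fo j, trg = L, part = (\<lambda>n. \<iota> n j)\<rparr>)"
    using colimit_C_inf_degreewise[OF F colim] .
  then show thesis
    using colim by (intro that) auto
qed


section \<open>Powers of the differential on limits and colimits\<close>

lemma (in category) diff_pow_comm:
  assumes f: "is_complex_map C f"
  shows "Comp C (diff_pow C (trg f) N n) (part f n) =
    Comp C (part f (n + int N)) (diff_pow C (src f) N n)"
proof (induction N)
  case 0
  show ?case
    using complex_map_in_hom[OF f, of n] by (simp add: comp_id_left comp_id_right)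
next
  case (Suc N)
  have X: "is_complex C (src f)" and Y: "is_complex C (trg f)"
    using f by (auto simp: is_complex_map_def)
  note part = complex_map_in_hom[OF f]
  note powX = diff_pow_in_hom[OF category_axioms X, of N n]
  note powY = diff_pow_in_hom[OF category_axioms Y, of N n]
  note dX = complex_in_hom[OF X, of "n + int N"]
  note dY = complex_in_hom[OF Y, of "n + int N"]
  have "Comp C (diff_pow C (trg f) (Suc N) n) (part f n) =
      Comp C (Comp C (diff (trg f) (n + int N)) (part f (n + int N))) (diff_pow C (src f) N n)"
    using comp_assoc[OF part powY dY] comp_assoc[OF powX part dY] Suc by simp
  also have "\<dots> = Comp C (part f (n + int N + 1)) (diff_pow C (src f) (Suc N) n)"
    using comp_assoc[OF powX dX part] complex_map_comm[OF f, of "n + int N"] by simp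
  finally show ?case
    by (simp add: algebra_simps)
qed

text \<open>A zero arrow between the components of \<open>L\<close> has to come from a zero object of \<open>C\<close>, not from the
  diagram, which may be empty. Composed with a projection, \<open>d\<^sup>N\<close> factors through the power of the
  differential of a complex in the diagram, so both composites are zero arrows.\<close>

lemma (in category) zero_diff_pow_limit:
  assumes "pointed C" and F: "is_functor J (C_inf C) Fo Fa"
    and cone: "is_cone J (C_inf C) Fo Fa L p"
    and lim: "\<And>n. is_limit J C (\<lambda>j. ob (Fo j) n) (\<lambda>u. part (Fa u) n) (ob L n) (\<lambda>j. part (p j) n)"
    and zero: "\<And>j n. j \<in> Obj J \<Longrightarrow> zero_arrow C (diff_pow C (Fo j) N n)"
  shows "zero_arrow C (diff_pow C L N n)"
proof -
  have L: "is_complex C L"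
    and p: "\<And>j. j \<in> Obj J \<Longrightarrow> is_complex_map C (p j) \<and> src (p j) = L \<and> trg (p j) = Fo j"
    using cone by (auto simp: is_cone_C_inf[OF F])
  note pow = diff_pow_in_hom[OF category_axioms L, of N n]
  obtain z where z: "zero_arrow C z" "in_hom C z (ob L n) (ob L (n + int N))"
    using zero_arrow_exists[OF assms(1)] complex_ob[OF L] by metis
  have "diff_pow C L N n = z"
  proof (rule limit_arrow_eqI[OF lim _ pow z(2)])
    show "in_hom C (part (Fa u) (n + int N)) (ob (Fo i) (n + int N)) (ob (Fo j) (n + int N))"
      if "in_hom J u i j" for u i j
      using functor_C_inf_Fa[OF F that] complex_map_in_hom by metis
    fix j assume j: "j \<in> Obj J"
    have pj: "in_hom C (part (p j) m) (ob L m) (ob (Fo j) m)" for m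
      using p[OF j] complex_map_in_hom by metis
    note powF = diff_pow_in_hom[OF category_axioms functor_C_inf_Fo[OF F j], of N n]
    have "zero_arrow C (Comp C (part (p j) (n + int N)) (diff_pow C L N n))"
      using zero_arrow_comp_right[OF zero[OF j] powF pj] diff_pow_comm[of "p j" N n] p[OF j]
      by simp
    then show "Comp C (part (p j) (n + int N)) (diff_pow C L N n) =
        Comp C (part (p j) (n + int N)) z"
      using zero_arrow_unique zero_arrow_comp_left[OF z pj] comp_in_hom[OF pow pj]
        comp_in_hom[OF z(2) pj] by blast
  qed
  then show ?thesis
    using z by simp
qed

lemma (in category) zero_diff_pow_colimit:
  assumes "pointed C" and F: "is_functor J (C_inf C) Fo Fa"
    and cocone: "is_cocone J (C_inf C) Fo Fa L p"
    and colim: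
      "\<And>n. is_colimit J C (\<lambda>j. ob (Fo j) n) (\<lambda>u. part (Fa u) n) (ob L n) (\<lambda>j. part (p j) n)"
    and zero: "\<And>j n. j \<in> Obj J \<Longrightarrow> zero_arrow C (diff_pow C (Fo j) N n)"
  shows "zero_arrow C (diff_pow C L N n)"
proof -
  have L: "is_complex C L"
    and p: "\<And>j. j \<in> Obj J \<Longrightarrow> is_complex_map C (p j) \<and> src (p j) = Fo j \<and> trg (p j) = L"
    using cocone by (auto simp: is_cocone_C_inf[OF F])
  note pow = diff_pow_in_hom[OF category_axioms L, of N n]
  obtain z where z: "zero_arrow C z" "in_hom C z (ob L n) (ob L (n + int N))"
    using zero_arrow_exists[OF assms(1)] complex_ob[OF L] by metis
  have "diff_pow C L N n = z"
  proof (rule colimit_arrow_eqI[OF colim _ pow z(2)])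
    show "in_hom C (part (Fa u) n) (ob (Fo i) n) (ob (Fo j) n)" if "in_hom J u i j" for u i j
      using functor_C_inf_Fa[OF F that] complex_map_in_hom by metis
    fix j assume j: "j \<in> Obj J"
    have pj: "in_hom C (part (p j) m) (ob (Fo j) m) (ob L m)" for m
      using p[OF j] complex_map_in_hom by metis
    note powF = diff_pow_in_hom[OF category_axioms functor_C_inf_Fo[OF F j], of N n]
    have "zero_arrow C (Comp C (diff_pow C L N n) (part (p j) n))"
      using zero_arrow_comp_left[OF zero[OF j] powF pj] diff_pow_comm[of "p j" N n] p[OF j]
      by simp
    then show "Comp C (diff_pow C L N n) (part (p j) n) = Comp C z (part (p j) n)"
      using zero_arrow_unique zero_arrow_comp_right[OF z pj] comp_in_hom[OF pj pow]
        comp_in_hom[OF pj z(2)] by blast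
  qed
  then show ?thesis
    using z by simp
qed


section \<open>Completeness and cocompleteness\<close>

lemma (in category) has_limits_C_inf: "has_limits U C \<Longrightarrow> has_limits U (C_inf C)"
  unfolding has_limits_def[of U "C_inf C"] by (metis has_limits_degreewise)

lemma (in category) has_colimits_C_inf: "has_colimits U C \<Longrightarrow> has_colimits U (C_inf C)"
  unfolding has_colimits_def[of U "C_inf C"] by (metis has_colimits_degreewise)

lemma (in category) has_limits_C_N:
  assumes "pointed C" "has_limits U C"
  shows "has_limits U (C_N N C)"
  unfolding has_limits_def
proof (intro allI impI, elim conjE)
  fix J Fo Fa
  assume J: "small_category U J" and "is_functor J (C_N N C) Fo Fa"
  then have F: "is_functor J (C_inf C) Fo Fa"
    and zero: "\<And>j n. j \<in> Obj J \<Longrightarrow> zero_arrow C (diff_pow C (Fo j) N n)"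
    by (auto simp: C_N_def is_functor_full_subcat)
  obtain L p where L: "is_limit J (C_inf C) Fo Fa L p"
    and lim: "\<And>n. is_limit J C (\<lambda>j. ob (Fo j) n) (\<lambda>u. part (Fa u) n) (ob L n) (\<lambda>j. part (p j) n)"
    using has_limits_degreewise[OF assms(2) J F] by blast
  from L have "is_cone J (C_inf C) Fo Fa L p"
    by (simp add: is_limit_def)
  then have "zero_arrow C (diff_pow C L N n)" for n
    using zero_diff_pow_limit[OF assms(1) F _ lim zero] by blast
  then have "is_limit J (C_N N C) Fo Fa L p"
    unfolding C_N_def using L zero by (intro is_limit_full_subcat) auto
  then show "\<exists>L p. is_limit J (C_N N C) Fo Fa L p"
    by blast
qed

lemma (in category) has_colimits_C_N:
  assumes "pointed C" "has_colimits U C"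
  shows "has_colimits U (C_N N C)"
  unfolding has_colimits_def
proof (intro allI impI, elim conjE)
  fix J Fo Fa
  assume J: "small_category U J" and "is_functor J (C_N N C) Fo Fa"
  then have F: "is_functor J (C_inf C) Fo Fa"
    and zero: "\<And>j n. j \<in> Obj J \<Longrightarrow> zero_arrow C (diff_pow C (Fo j) N n)"
    by (auto simp: C_N_def is_functor_full_subcat)
  obtain L p where L: "is_colimit J (C_inf C) Fo Fa L p"
    and colim:
      "\<And>n. is_colimit J C (\<lambda>j. ob (Fo j) n) (\<lambda>u. part (Fa u) n) (ob L n) (\<lambda>j. part (p j) n)"
    using has_colimits_degreewise[OF assms(2) J F] by blast
  from L have "is_cocone J (C_inf C) Fo Fa L p"
    by (simp add: is_colimit_def)
  then have "zero_arrow C (diff_pow C L N n)" for n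
    using zero_diff_pow_colimit[OF assms(1) F _ colim zero] by blast
  then have "is_colimit J (C_N N C) Fo Fa L p"
    unfolding C_N_def using L zero by (intro is_colimit_full_subcat) auto
  then show "\<exists>L p. is_colimit J (C_N N C) Fo Fa L p"
    by blast
qed

theorem proposition1p10:
  fixes C :: "('o, 'm) cat" and U :: "'u set set"
  assumes "category C"
  shows "(has_colimits U C \<longrightarrow> has_colimits U (C_inf C)) \<and>
         (has_limits U C \<longrightarrow> has_limits U (C_inf C)) \<and>
         (pointed C \<longrightarrow>
            (\<forall>N. (has_colimits U C \<longrightarrow> has_colimits U (C_N N C)) \<and>
                 (has_limits U C \<longrightarrow> has_limits U (C_N N C))))"
proof -
  interpret category C by fact
  show ?thesis
    using has_limits_C_inf has_colimits_C_inf has_limits_C_N has_colimits_C_N by blast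
qed

end
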